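(* Let $A$ be a nonempty set and let $\mathcal{F} \subseteq \mathcal{O}_A$ be a set of operations on $A$. The following are equivalent. (i) $\mathcal{F}$ is the universe of a preclone of operations on $A$, and $\mathcal{F}$ is locally closed. (ii) $\mathcal{F}$ is characterized by some set of matrix collections on $A$; that is, there is a set $\mathcal{M} \subseteq \mathcal{M}_A$ such that $\mathcal{F} = \{f \in \mathcal{O}_A \mid \forall \Gamma \in \mathcal{M} \colon f \vartriangleright \Gamma\}$.
   Context: Operations. An operation on $A$ is a map $f \colon A^n \to A$ for some integer $n \geq 1$ (the arity of $f$). $\mathcal{O}_A^{(n)}$ is the set of all $n$-ary operations on $A$, and $\mathcal{O}_A := \bigcup_{n \geq 1} \mathcal{O}_A^{(n)}$. Preclones of operations. For $f \in \mathcal{O}_A^{(n)}$ and $g_i \in \mathcal{O}_A^{(m_i)}$ ($1 \leq i \leq n$), the superposition $f \ast (g_1, \dots, g_n)$ is the operation of arity $m = \sum_{i=1}^n m_i$ given by $$\bigl( f \ast (g_1, \dotsc, g_n) \bigr)(a_{1,1}, \dotsc, a_{1,m_1}, \dotsc, a_{n,1}, \dotsc, a_{n,m_n}) = f\bigl( g_1(a_{1,1}, \dotsc, a_{1,m_1}), \dotsc, g_n(a_{n,1}, \dotsc, a_{n,m_n}) \bigr)$$ for all $a_{i,j} \in A$. The full preclone of operations on $A$ is the heterogeneous algebra with base sets $\mathcal{O}_A^{(n)}$ ($n \geq 1$), all superpositions as operations, and the unary projection (identity map) $x_1^{(1)}$ as distinguished element; its subalgebras are called preclones of operations on $A$. Thus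 $\mathcal{F} \subseteq \mathcal{O}_A$ is the universe of a preclone of operations on $A$ iff $x_1^{(1)} \in \mathcal{F}$ and $f \ast (g_1, \dots, g_n) \in \mathcal{F}$ whenever $f, g_1, \dots, g_n \in \mathcal{F}$ with $f$ $n$-ary. Local closure. $\mathcal{F}$ is locally closed if for all $n \geq 1$ and all $f \colon A^n \to A$: $f \in \mathcal{F}$ whenever for every finite subset $S \subseteq A^n$ there exists an ($n$-ary) $g \in \mathcal{F}$ such that $f|_S = g|_S$. Matrix collections. $A^{m \times n}$ is the set of matrices with $m$ rows and $n$ columns with entries in $A$. For $m \geq 1$, an $m$-ary matrix collection on $A$ is a subset $\Gamma \subseteq \bigcup_{p \geq 0} A^{m \times p}$ (for $p=0$ there is a unique, empty, matrix); $\mathcal{M}_A^{(m)}$ is the set of all $m$-ary matrix collections, and $\mathcal{M}_A := \bigcup_{m \geq 1} \mathcal{M}_A^{(m)}$. $[\mathbf{M}_1 | \mathbf{M}_2 | \cdots]$ denotes horizontal juxtaposition of matrices with the same number of rows (matrices with $0$ columns allowed). Preservation. For $f \in \mathcal{O}_A^{(n)}$ and $\mathbf{M} \in A^{m \times n}$, $f\mathbf{M}$ is the column vector ($m \times 1$ matrix) obtained by applying $f$ to each row of $\mathbf{M}$. An operation $f \in \mathcal{O}_A^{(n)}$ preserves $\Gamma \in \mathcal{M}_A^{(m)}$, written $f \vartriangleright \Gamma$, if for all $m$-row matrices $\mathbf{M} = [\mathbf{M}_1 | \mathbf{M}_2 | \mathbf{M}_3]$ where $\mathbf{M}_2$ has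 $n$ columns, $\mathbf{M} \in \Gamma$ implies $[\mathbf{M}_1 | f\mathbf{M}_2 | \mathbf{M}_3] \in \Gamma$. *)

theory Defs
  imports "Jordan_Normal_Form.Matrix" "HOL-Library.FuncSet" "HOL-Library.NList"
begin

section \<open>Operations\<close>

text \<open>
  The set $A^n$ is \<^term>\<open>nlists n A\<close>. An operation carries its arity explicitly, and its
  underlying function is extensional (it is \<^const>\<open>undefined\<close> outside $A^n$), so that distinct
  pairs are distinct operations. The arity is not redundant: if \<^prop>\<open>A = {undefined}\<close>, then
  the extensional functions of all arities coincide.
\<close>

type_synonym 'a operation = "nat \<times> ('a list \<Rightarrow> 'a)"

definition operations_of_arity :: "'a set \<Rightarrow> nat \<Rightarrow> 'a operation set" where
  "operations_of_arity A n = {n} \<times> (nlists n A \<rightarrow>\<^sub>E A)"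

definition operations :: "'a set \<Rightarrow> 'a operation set" where
  "operations A = (\<Union>n\<in>{1..}. operations_of_arity A n)"

definition identity_operation :: "'a set \<Rightarrow> 'a operation" where
  "identity_operation A = (1, \<lambda>xs\<in>nlists 1 A. hd xs)"

text \<open>
  \<open>apply_blocks [(m\<^sub>1, g\<^sub>1), \<dots>, (m\<^sub>n, g\<^sub>n)] xs\<close> cuts \<open>xs\<close> into consecutive blocks of
  lengths \<open>m\<^sub>1, \<dots>, m\<^sub>n\<close> and applies \<open>g\<^sub>i\<close> to the \<open>i\<close>-th block.
\<close>

fun apply_blocks :: "'a operation list \<Rightarrow> 'a list \<Rightarrow> 'a list" where
  "apply_blocks [] xs = []"
| "apply_blocks ((m, g) # gs) xs = g (take m xs) # apply_blocks gs (drop m xs)"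

text \<open>The superposition is meaningful if the arity of the first argument is \<^term>\<open>length gs\<close>.\<close>

definition superposition :: "'a set \<Rightarrow> 'a operation \<Rightarrow> 'a operation list \<Rightarrow> 'a operation" where
  "superposition A f gs =
     (let m = sum_list (map fst gs)
      in (m, \<lambda>xs\<in>nlists m A. snd f (apply_blocks gs xs)))"

lemma apply_blocks_concat:
  assumes "list_all2 (\<lambda>g xs. length xs = fst g) gs xss"
  shows "apply_blocks gs (concat xss) = map2 (\<lambda>g xs. snd g xs) gs xss"
  using assms
proof (induction gs arbitrary: xss)
  case (Cons g gs)
  then show ?case by (cases g; cases xss) simp_all
qed simp

lemma superposition_concat:
  assumes "list_all2 (\<lambda>g xs. xs \<in> nlists (fst g) A) gs xss"
  shows "snd (superposition A f gs) (concat xss) = snd f (map2 (\<lambda>g xs. snd g xs) gs xss)"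
proof -
  have "list_all2 (\<lambda>g xs. length xs = fst g) gs xss \<and>
      length (concat xss) = sum_list (map fst gs) \<and> set (concat xss) \<subseteq> A"
    using assms
  proof (induction gs arbitrary: xss)
    case (Cons g gs)
    then obtain ys yss where xss: "xss = ys # yss" and ys: "ys \<in> nlists (fst g) A"
        and yss: "list_all2 (\<lambda>g xs. xs \<in> nlists (fst g) A) gs yss"
      by (cases xss) simp_all
    from ys have "length ys = fst g" "set ys \<subseteq> A" by (simp_all only: nlists_def mem_Collect_eq)
    with Cons.IH[OF yss] show ?case by (simp add: xss)
  qed simp
  then show ?thesis
    by (simp only: superposition_def Let_def snd_conv restrict_apply if_True
        apply_blocks_concat nlists_def mem_Collect_eq simp_thms)
qed


section \<open>Preclones and local closure\<close>

definition preclone :: "'a set \<Rightarrow> 'a operation set \<Rightarrow> bool" where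
  "preclone A F \<longleftrightarrow>
     F \<subseteq> operations A \<and>
     identity_operation A \<in> F \<and>
     (\<forall>f\<in>F. \<forall>gs. set gs \<subseteq> F \<and> length gs = fst f \<longrightarrow> superposition A f gs \<in> F)"

definition locally_closed :: "'a set \<Rightarrow> 'a operation set \<Rightarrow> bool" where
  "locally_closed A F \<longleftrightarrow>
     (\<forall>n\<ge>1. \<forall>f\<in>nlists n A \<rightarrow>\<^sub>E A.
        (\<forall>S. finite S \<and> S \<subseteq> nlists n A \<longrightarrow> (\<exists>g. (n, g) \<in> F \<and> (\<forall>xs\<in>S. f xs = g xs)))
        \<longrightarrow> (n, f) \<in> F)"


section \<open>Matrix collections and preservation\<close>

definition matrix_collections_of_arity :: "'a set \<Rightarrow> nat \<Rightarrow> 'a mat set set" where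
  "matrix_collections_of_arity A m = Pow (\<Union>p. {M \<in> carrier_mat m p. elements_mat M \<subseteq> A})"

definition matrix_collections :: "'a set \<Rightarrow> 'a mat set set" where
  "matrix_collections A = (\<Union>m\<in>{1..}. matrix_collections_of_arity A m)"

text \<open>Only used for matrices with the same number of rows.\<close>

definition juxtapose :: "'a mat \<Rightarrow> 'a mat \<Rightarrow> 'a mat" where
  "juxtapose M N = mat (dim_row M) (dim_col M + dim_col N)
     (\<lambda>(i, j). if j < dim_col M then M $$ (i, j) else N $$ (i, j - dim_col M))"

definition apply_to_rows :: "('a list \<Rightarrow> 'a) \<Rightarrow> 'a mat \<Rightarrow> 'a mat" where
  "apply_to_rows f M = mat (dim_row M) 1 (\<lambda>(i, j). f (list_of_vec (row M i)))"

text \<open>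
  The number of rows \<open>m\<close> is quantified rather than passed as the arity of \<open>\<Gamma>\<close>: all members of
  an \<open>m\<close>-ary collection have \<open>m\<close> rows, so the condition is vacuous for any other row number.
\<close>

definition preserves :: "'a operation \<Rightarrow> 'a mat set \<Rightarrow> bool" where
  "preserves f \<Gamma> \<longleftrightarrow>
     (\<forall>m p q. \<forall>M\<^sub>1\<in>carrier_mat m p. \<forall>M\<^sub>2\<in>carrier_mat m (fst f). \<forall>M\<^sub>3\<in>carrier_mat m q.
        juxtapose M\<^sub>1 (juxtapose M\<^sub>2 M\<^sub>3) \<in> \<Gamma> \<longrightarrow>
        juxtapose M\<^sub>1 (juxtapose (apply_to_rows (snd f) M\<^sub>2) M\<^sub>3) \<in> \<Gamma>)"

end

theory Submission
  imports Defs
begin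

text \<open>
  Every set of matrix collections characterizes a locally closed preclone: a superposition
  \<open>f \<ast> (g\<^sub>1, \<dots>, g\<^sub>n)\<close> acts on a block of columns by replacing its subblocks one after the other by
  the columns produced by the \<open>g\<^sub>i\<close>, and then applying \<open>f\<close>; and a matrix has only finitely
  many rows. Conversely, given a locally closed preclone \<open>F\<close>, an operation \<open>f\<close> preserving all
  collections preserved by \<open>F\<close>, and a nonempty finite \<open>S \<subseteq> A\<^sup>n\<close>, let \<open>M\<close> be the matrix with
  row set \<open>S\<close>. The matrices \<open>[g\<^sub>1 M\<^sub>1 | \<dots> | g\<^sub>k M\<^sub>k]\<close> with \<open>g\<^sub>i \<in> F\<close> and
  \<open>M = [M\<^sub>1 | \<dots> | M\<^sub>k]\<close> form a collection preserved by \<open>F\<close> and containing \<open>M\<close>. Hence it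
  contains the single column \<open>f M\<close>, which is therefore \<open>g M\<close> for some \<open>g \<in> F\<close>.
\<close>

\<comment> \<open>These conditional rules make the simplifier loop together with \<open>in_nlists_iff\<close> below.\<close>
declare nlistsE_length [simp del] nlistsE_set [simp del]

lemma in_nlists_iff: "xs \<in> nlists n A \<longleftrightarrow> length xs = n \<and> set xs \<subseteq> A"
  by (simp add: nlists_def)

section \<open>Matrices given by lists of rows\<close>

definition matrix_of :: "nat \<Rightarrow> nat \<Rightarrow> (nat \<Rightarrow> 'a list) \<Rightarrow> 'a mat" where
  "matrix_of m p r = mat m p (\<lambda>(i, j). r i ! j)"

lemma matrix_of_carrier [simp]: "matrix_of m p r \<in> carrier_mat m p"
  by (simp add: matrix_of_def)

lemma matrix_of_rows:
  assumes "M \<in> carrier_mat m p"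
  shows "matrix_of m p (\<lambda>i. list_of_vec (row M i)) = M"
  using assms by (intro eq_matI) (auto simp: matrix_of_def list_of_vec_index)

lemma list_of_row_matrix_of:
  assumes "i < m" "length (r i) = p"
  shows "list_of_vec (row (matrix_of m p r) i) = r i"
  using assms by (intro nth_equalityI) (auto simp: matrix_of_def list_of_vec_index)

lemma matrix_of_eq_iff:
  assumes "\<And>i. i < m \<Longrightarrow> length (r i) = p" "\<And>i. i < m \<Longrightarrow> length (r' i) = p'"
  shows "matrix_of m p r = matrix_of m p' r' \<longleftrightarrow> p = p' \<and> (\<forall>i<m. r i = r' i)"
proof
  assume eq: "matrix_of m p r = matrix_of m p' r'"
  then have "p = p'" by (metis matrix_of_carrier carrier_matD(2))
  moreover have "r i = r' i" if "i < m" for i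
    using that eq assms list_of_row_matrix_of by metis
  ultimately show "p = p' \<and> (\<forall>i<m. r i = r' i)" by blast
qed (auto simp: matrix_of_def intro!: eq_matI)

lemma matrix_of_cong:
  "\<lbrakk>p = p'; \<And>i. i < m \<Longrightarrow> r i = r' i\<rbrakk> \<Longrightarrow> matrix_of m p r = matrix_of m p' r'"
  by (auto simp: matrix_of_def intro!: eq_matI)

lemma juxtapose_matrix_of:
  assumes "\<And>i. i < m \<Longrightarrow> length (r i) = p"
  shows "juxtapose (matrix_of m p r) (matrix_of m q s) = matrix_of m (p + q) (\<lambda>i. r i @ s i)"
  using assms by (auto simp: juxtapose_def matrix_of_def nth_append intro!: eq_matI)

lemma apply_to_rows_matrix_of:
  assumes "\<And>i. i < m \<Longrightarrow> length (r i) = n"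
  shows "apply_to_rows f (matrix_of m n r) = matrix_of m 1 (\<lambda>i. [f (r i)])"
proof (rule eq_matI)
  fix i j
  assume "i < dim_row (matrix_of m 1 (\<lambda>i. [f (r i)]))"
    and "j < dim_col (matrix_of m 1 (\<lambda>i. [f (r i)]))"
  then have "i < m" "j = 0" by (simp_all add: matrix_of_def)
  then show "apply_to_rows f (matrix_of m n r) $$ (i, j) = matrix_of m 1 (\<lambda>i. [f (r i)]) $$ (i, j)"
    using list_of_row_matrix_of[of i m r n] assms by (simp add: apply_to_rows_def matrix_of_def)
qed (simp_all add: apply_to_rows_def matrix_of_def)

lemma elements_matrix_of_subset_iff:
  assumes "\<And>i. i < m \<Longrightarrow> length (r i) = p"
  shows "elements_mat (matrix_of m p r) \<subseteq> A \<longleftrightarrow> (\<forall>i<m. set (r i) \<subseteq> A)"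
proof -
  have "elements_mat (matrix_of m p r) = {r i ! j |i j. i < m \<and> j < p}"
    by (force simp: elements_mat_def matrix_of_def)
  then show ?thesis
    using assms by (fastforce simp: in_set_conv_nth subset_iff)
qed

text \<open>The form in which preservation is used below: matrices are given row by row as lists, so
  that juxtaposition becomes concatenation.\<close>

lemma preserves_iff:
  "preserves f \<Gamma> \<longleftrightarrow>
    (\<forall>m p q r s t. (\<forall>i. length (r i) = p \<and> length (s i) = fst f \<and> length (t i) = q) \<longrightarrow>
      matrix_of m (p + (fst f + q)) (\<lambda>i. r i @ s i @ t i) \<in> \<Gamma> \<longrightarrow>
      matrix_of m (p + (1 + q)) (\<lambda>i. r i @ [snd f (s i)] @ t i) \<in> \<Gamma>)"
    (is "_ \<longleftrightarrow> ?rhs")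
proof
  assume *: "preserves f \<Gamma>"
  show ?rhs
  proof (intro allI impI)
    fix m p q and r s t :: "nat \<Rightarrow> 'a list"
    assume len: "\<forall>i. length (r i) = p \<and> length (s i) = fst f \<and> length (t i) = q"
      and "matrix_of m (p + (fst f + q)) (\<lambda>i. r i @ s i @ t i) \<in> \<Gamma>"
    then have "juxtapose (matrix_of m p r) (juxtapose (matrix_of m (fst f) s) (matrix_of m q t)) \<in> \<Gamma>"
      by (simp add: juxtapose_matrix_of)
    with * have "juxtapose (matrix_of m p r)
        (juxtapose (apply_to_rows (snd f) (matrix_of m (fst f) s)) (matrix_of m q t)) \<in> \<Gamma>"
      unfolding preserves_def by (meson matrix_of_carrier)
    then show "matrix_of m (p + (1 + q)) (\<lambda>i. r i @ [snd f (s i)] @ t i) \<in> \<Gamma>"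
      using len by (simp add: juxtapose_matrix_of apply_to_rows_matrix_of)
  qed
next
  assume *: ?rhs
  show "preserves f \<Gamma>"
    unfolding preserves_def
  proof (intro allI ballI impI)
    fix m p q and M\<^sub>1 M\<^sub>2 M\<^sub>3 :: "'a mat"
    assume M: "M\<^sub>1 \<in> carrier_mat m p" "M\<^sub>2 \<in> carrier_mat m (fst f)" "M\<^sub>3 \<in> carrier_mat m q"
      and mem: "juxtapose M\<^sub>1 (juxtapose M\<^sub>2 M\<^sub>3) \<in> \<Gamma>"
    obtain r s t where len: "\<forall>i. length (r i) = p \<and> length (s i) = fst f \<and> length (t i) = q"
      and rst: "M\<^sub>1 = matrix_of m p r" "M\<^sub>2 = matrix_of m (fst f) s" "M\<^sub>3 = matrix_of m q t"
    proof
      \<comment> \<open>The length condition ranges over all \<open>i\<close>. It holds even past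
        the last row, since \<open>row M i\<close> always has dimension
        \<open>dim_col M\<close>.\<close>
      show "\<forall>i. length (list_of_vec (row M\<^sub>1 i)) = p \<and> length (list_of_vec (row M\<^sub>2 i)) = fst f
          \<and> length (list_of_vec (row M\<^sub>3 i)) = q"
        using M by simp
    qed (simp_all only: matrix_of_rows M)
    show "juxtapose M\<^sub>1 (juxtapose (apply_to_rows (snd f) M\<^sub>2) M\<^sub>3) \<in> \<Gamma>"
      using *[rule_format, OF len[rule_format], of m] mem len
      by (simp add: rst juxtapose_matrix_of apply_to_rows_matrix_of)
  qed
qed

lemma preservesD:
  assumes "preserves f \<Gamma>"
    and "\<And>i. length (r i) = p" "\<And>i. length (s i) = fst f" "\<And>i. length (t i) = q"
    and "matrix_of m (p + (fst f + q)) (\<lambda>i. r i @ s i @ t i) \<in> \<Gamma>"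
  shows "matrix_of m (p + (1 + q)) (\<lambda>i. r i @ [snd f (s i)] @ t i) \<in> \<Gamma>"
  using assms unfolding preserves_iff by blast

section \<open>Cutting rows into blocks, and superpositions as operations\<close>

lemma length_apply_blocks [simp]: "length (apply_blocks gs xs) = length gs"
  by (induction gs xs rule: apply_blocks.induct) simp_all

lemma apply_blocks_append:
  "apply_blocks (gs @ hs) xs =
    apply_blocks gs xs @ apply_blocks hs (drop (sum_list (map fst gs)) xs)"
  by (induction gs xs rule: apply_blocks.induct) (simp_all add: add.commute)

text \<open>Lets blocks be evaluated on a tail of a row that still contains the entries of later
  blocks.\<close>

lemma apply_blocks_take:
  "apply_blocks gs (take (sum_list (map fst gs)) xs) = apply_blocks gs xs"
proof (induction gs xs rule: apply_blocks.induct)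
  case (2 m g gs xs)
  then show ?case by (simp add: drop_take min_def)
qed simp

lemma set_apply_blocks:
  assumes "set gs \<subseteq> operations A" "xs \<in> nlists (sum_list (map fst gs)) A"
  shows "set (apply_blocks gs xs) \<subseteq> A"
  using assms
proof (induction gs xs rule: apply_blocks.induct)
  case (2 m g gs xs)
  have "length xs = m + sum_list (map fst gs)" "set xs \<subseteq> A"
    using "2.prems"(2) by (simp_all add: in_nlists_iff)
  then have "take m xs \<in> nlists m A" "drop m xs \<in> nlists (sum_list (map fst gs)) A"
    using set_take_subset[of m xs] set_drop_subset[of m xs] by (auto simp: in_nlists_iff)
  moreover have "g \<in> nlists m A \<rightarrow>\<^sub>E A"
    using "2.prems"(1) by (auto simp: operations_def operations_of_arity_def)
  ultimately have "g (take m xs) \<in> A" "set (apply_blocks gs (drop m xs)) \<subseteq> A"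
    using "2.IH" "2.prems"(1) by auto
  then show ?case by simp
qed simp

lemma identity_operation_in_operations: "identity_operation A \<in> operations A"
proof -
  have "hd xs \<in> A" if "xs \<in> nlists 1 A" for xs
    using that by (auto simp: in_nlists_iff length_Suc_conv)
  then show ?thesis
    by (auto simp: identity_operation_def operations_def operations_of_arity_def)
qed

lemma superposition_apply:
  assumes "xs \<in> nlists (sum_list (map fst gs)) A"
  shows "snd (superposition A f gs) xs = snd f (apply_blocks gs xs)"
  using assms by (simp add: superposition_def Let_def)

lemma fst_superposition [simp]: "fst (superposition A f gs) = sum_list (map fst gs)"
  by (simp add: superposition_def Let_def)

lemma superposition_in_operations:
  assumes f: "f \<in> operations A" and gs: "set gs \<subseteq> operations A" and len: "length gs = fst f"
  shows "superposition A f gs \<in> operations A"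
proof -
  let ?m = "sum_list (map fst gs)"
  have f': "fst f \<ge> 1" "snd f \<in> nlists (fst f) A \<rightarrow>\<^sub>E A"
    using f by (auto simp: operations_def operations_of_arity_def)
  \<comment> \<open>Since \<open>f\<close> has positive arity, \<open>gs\<close> has a first member,
    whose own arity already makes \<open>?m\<close> positive.\<close>
  then obtain g gs' where "gs = g # gs'" using len by (cases gs) auto
  then have "?m \<ge> 1"
    using gs by (auto simp: operations_def operations_of_arity_def)
  moreover have "snd f (apply_blocks gs xs) \<in> A" if "xs \<in> nlists ?m A" for xs
    using f'(2) set_apply_blocks[OF gs that] len by (auto simp: in_nlists_iff)
  ultimately show ?thesis
    by (auto simp: operations_def operations_of_arity_def superposition_def Let_def)
qed

section \<open>Closure properties of the operations preserving a collection\<close>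

text \<open>The identity and superpositions are \<open>undefined\<close> outside lists over
  \<open>A\<close>, so evaluating them on a row requires its entries to lie in
  \<open>A\<close>.\<close>

lemma matrix_of_in_collectionD:
  assumes "\<Gamma> \<in> matrix_collections A" "matrix_of m p r \<in> \<Gamma>"
    and "\<And>i. i < m \<Longrightarrow> length (r i) = p" and "i < m"
  shows "set (r i) \<subseteq> A"
proof -
  have "elements_mat (matrix_of m p r) \<subseteq> A"
    using assms(1,2) by (auto simp: matrix_collections_def matrix_collections_of_arity_def)
  then show ?thesis using assms(3,4) by (simp add: elements_matrix_of_subset_iff)
qed

text \<open>Replacing one column by its image under the identity leaves the matrix
  unchanged.\<close>

lemma preserves_identity_operation:
  assumes "\<Gamma> \<in> matrix_collections A"
  shows "preserves (identity_operation A) \<Gamma>"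
  unfolding preserves_iff
proof (intro allI impI)
  fix m p q and r s t :: "nat \<Rightarrow> 'a list"
  assume len: "\<forall>i. length (r i) = p \<and> length (s i) = fst (identity_operation A) \<and> length (t i) = q"
    and mem: "matrix_of m (p + (fst (identity_operation A) + q)) (\<lambda>i. r i @ s i @ t i) \<in> \<Gamma>"
  have len1: "length (s i) = 1" for i using len by (simp add: identity_operation_def)
  have "[snd (identity_operation A) (s i)] = s i" if "i < m" for i
  proof -
    have "set (r i @ s i @ t i) \<subseteq> A"
      by (rule matrix_of_in_collectionD[OF assms mem _ that]) (simp add: len)
    moreover obtain x where "s i = [x]" using len1[of i] by (auto simp: length_Suc_conv)
    ultimately show ?thesis by (simp add: identity_operation_def in_nlists_iff)
  qed
  then have "matrix_of m (p + (1 + q)) (\<lambda>i. r i @ [snd (identity_operation A) (s i)] @ t i) =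
      matrix_of m (p + (fst (identity_operation A) + q)) (\<lambda>i. r i @ s i @ t i)"
    by (intro matrix_of_cong) (auto simp: identity_operation_def)
  then show "matrix_of m (p + (1 + q)) (\<lambda>i. r i @ [snd (identity_operation A) (s i)] @ t i) \<in> \<Gamma>"
    using mem by simp
qed

text \<open>The blocks are replaced one at a time from the left. Each new column joins the left
  part, so \<open>p\<close>, \<open>r\<close> and \<open>s\<close> vary in the induction.\<close>

lemma preserves_apply_blocks:
  assumes "\<forall>g\<in>set gs. preserves g \<Gamma>"
    and "\<And>i. length (r i) = p" "\<And>i. length (s i) = sum_list (map fst gs)" "\<And>i. length (t i) = q"
    and "matrix_of m (p + (sum_list (map fst gs) + q)) (\<lambda>i. r i @ s i @ t i) \<in> \<Gamma>"
  shows "matrix_of m (p + (length gs + q)) (\<lambda>i. r i @ apply_blocks gs (s i) @ t i) \<in> \<Gamma>"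
  using assms
proof (induction gs arbitrary: p r s)
  case Nil
  then show ?case by simp
next
  case (Cons h gs)
  obtain k g where h: "h = (k, g)" by (cases h)
  let ?n = "sum_list (map fst gs)"
  have len: "length (s i) = k + ?n" for i using Cons.prems(3) h by simp
  \<comment> \<open>While \<open>h\<close> acts on the first \<open>k\<close> columns, the blocks
    still to be treated count as part of the right-hand matrix.\<close>
  have "matrix_of m (p + (fst h + (?n + q))) (\<lambda>i. r i @ take k (s i) @ (drop k (s i) @ t i)) \<in> \<Gamma>"
    using Cons.prems(5) h by (simp add: add.assoc flip: append_assoc)
  then have "matrix_of m (p + (1 + (?n + q)))
      (\<lambda>i. r i @ [snd h (take k (s i))] @ (drop k (s i) @ t i)) \<in> \<Gamma>"
    using Cons.prems(1,2,4) len h by (intro preservesD) auto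
  then have "matrix_of m ((p + 1) + (?n + q))
      (\<lambda>i. (r i @ [g (take k (s i))]) @ drop k (s i) @ t i) \<in> \<Gamma>"
    using h by (simp add: add.assoc)
  then have "matrix_of m ((p + 1) + (length gs + q))
      (\<lambda>i. (r i @ [g (take k (s i))]) @ apply_blocks gs (drop k (s i)) @ t i) \<in> \<Gamma>"
    using Cons.prems(1,2,4) len by (intro Cons.IH) auto
  then show ?case using h by simp
qed

lemma preserves_superposition:
  assumes \<Gamma>: "\<Gamma> \<in> matrix_collections A" and f: "preserves f \<Gamma>"
    and gs: "\<forall>g\<in>set gs. preserves g \<Gamma>" and lgs: "length gs = fst f"
  shows "preserves (superposition A f gs) \<Gamma>"
  unfolding preserves_iff fst_superposition
proof (intro allI impI)
  fix m p q and r s t :: "nat \<Rightarrow> 'a list"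
  let ?n = "sum_list (map fst gs)"
  assume len: "\<forall>i. length (r i) = p \<and> length (s i) = ?n \<and> length (t i) = q"
    and mem: "matrix_of m (p + (?n + q)) (\<lambda>i. r i @ s i @ t i) \<in> \<Gamma>"
  have "matrix_of m (p + (fst f + q)) (\<lambda>i. r i @ apply_blocks gs (s i) @ t i) \<in> \<Gamma>"
    using preserves_apply_blocks[OF gs _ _ _ mem] len lgs by simp
  then have "matrix_of m (p + (1 + q)) (\<lambda>i. r i @ [snd f (apply_blocks gs (s i))] @ t i) \<in> \<Gamma>"
    using len lgs by (intro preservesD[OF f]) auto
  \<comment> \<open>Only rows with \<open>i < m\<close> are known to lie over \<open>A\<close>,
    where the restriction in \<open>superposition\<close> has no effect.\<close>
  moreover have "snd (superposition A f gs) (s i) = snd f (apply_blocks gs (s i))" if "i < m" for i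
  proof -
    have "set (r i @ s i @ t i) \<subseteq> A"
      by (rule matrix_of_in_collectionD[OF \<Gamma> mem _ that]) (simp add: len)
    then show ?thesis using len by (intro superposition_apply) (simp add: in_nlists_iff)
  qed
  then have "matrix_of m (p + (1 + q)) (\<lambda>i. r i @ [snd (superposition A f gs) (s i)] @ t i) =
      matrix_of m (p + (1 + q)) (\<lambda>i. r i @ [snd f (apply_blocks gs (s i))] @ t i)"
    by (intro matrix_of_cong) auto
  ultimately show
    "matrix_of m (p + (1 + q)) (\<lambda>i. r i @ [snd (superposition A f gs) (s i)] @ t i) \<in> \<Gamma>"
    by simp
qed

text \<open>One instance of preservation evaluates \<open>f\<close> only at the \<open>m\<close>
  rows of the middle block. The interpolating \<open>g\<close> may change from instance to
  instance.\<close>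

lemma preserves_local:
  assumes \<Gamma>: "\<Gamma> \<in> matrix_collections A"
    and loc: "\<And>S. finite S \<Longrightarrow> S \<subseteq> nlists n A \<Longrightarrow>
      \<exists>g. preserves (n, g) \<Gamma> \<and> (\<forall>xs\<in>S. f xs = g xs)"
  shows "preserves (n, f) \<Gamma>"
  unfolding preserves_iff fst_conv snd_conv
proof (intro allI impI)
  fix m p q and r s t :: "nat \<Rightarrow> 'a list"
  assume len: "\<forall>i. length (r i) = p \<and> length (s i) = n \<and> length (t i) = q"
    and mem: "matrix_of m (p + (n + q)) (\<lambda>i. r i @ s i @ t i) \<in> \<Gamma>"
  have "s i \<in> nlists n A" if "i < m" for i
  proof -
    have "set (r i @ s i @ t i) \<subseteq> A"
      by (rule matrix_of_in_collectionD[OF \<Gamma> mem _ that]) (simp add: len)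
    then show ?thesis using len by (simp add: in_nlists_iff)
  qed
  then obtain g where g: "preserves (n, g) \<Gamma>" and fg: "\<forall>xs\<in>s ` {..<m}. f xs = g xs"
    using loc[of "s ` {..<m}"] by auto
  have "matrix_of m (p + (1 + q)) (\<lambda>i. r i @ [f (s i)] @ t i) =
      matrix_of m (p + (1 + q)) (\<lambda>i. r i @ [snd (n, g) (s i)] @ t i)"
    using fg by (intro matrix_of_cong) auto
  also have "\<dots> \<in> \<Gamma>"
    using len mem by (intro preservesD[OF g]) auto
  finally show "matrix_of m (p + (1 + q)) (\<lambda>i. r i @ [f (s i)] @ t i) \<in> \<Gamma>" .
qed

section \<open>The collection generated by a matrix under a preclone\<close>

text \<open>The matrices \<open>[g\<^sub>1 M\<^sub>1 | \<dots> | g\<^sub>k M\<^sub>k]\<close> with \<open>g\<^sub>i \<in> F\<close>, where \<open>[M\<^sub>1 | \<dots> | M\<^sub>k]\<close> is the matrix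
  with the \<open>m\<close> rows \<open>r i\<close> of length \<open>n\<close>.\<close>

definition block_images :: "'a operation set \<Rightarrow> nat \<Rightarrow> nat \<Rightarrow> (nat \<Rightarrow> 'a list) \<Rightarrow> 'a mat set" where
  "block_images F m n r =
    {matrix_of m (length gs) (\<lambda>i. apply_blocks gs (r i)) |gs.
      set gs \<subseteq> F \<and> sum_list (map fst gs) = n}"

lemma block_images_in_matrix_collections:
  assumes "F \<subseteq> operations A" "m \<ge> 1" "\<And>i. i < m \<Longrightarrow> r i \<in> nlists n A"
  shows "block_images F m n r \<in> matrix_collections A"
proof -
  have "\<exists>p. M \<in> carrier_mat m p \<and> elements_mat M \<subseteq> A" if "M \<in> block_images F m n r" for M
  proof -
    obtain gs where gs: "set gs \<subseteq> F" "sum_list (map fst gs) = n"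
      and M: "M = matrix_of m (length gs) (\<lambda>i. apply_blocks gs (r i))"
      using \<open>M \<in> block_images F m n r\<close> by (auto simp: block_images_def)
    have "set (apply_blocks gs (r i)) \<subseteq> A" if "i < m" for i
      using gs assms(1,3) that by (intro set_apply_blocks) auto
    then have "elements_mat M \<subseteq> A"
      unfolding M by (subst elements_matrix_of_subset_iff) auto
    then show ?thesis using M matrix_of_carrier by blast
  qed
  then show ?thesis
    using assms(2) by (auto simp: matrix_collections_def matrix_collections_of_arity_def)
qed

text \<open>The columns to which \<open>f\<close> is applied come from a consecutive sublist
  \<open>g2\<close> of \<open>gs\<close>. Replacing \<open>g2\<close> by the single operation
  \<open>superposition A f g2\<close> of \<open>F\<close> keeps the total arity \<open>n\<close> and
  produces the new matrix.\<close>

lemma preserves_block_images: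
  assumes F: "preclone A F" and f: "f \<in> F" and x: "\<And>i. i < m \<Longrightarrow> x i \<in> nlists n A"
  shows "preserves f (block_images F m n x)"
  unfolding preserves_iff
proof (intro allI impI)
  fix m' p q and r s t :: "nat \<Rightarrow> 'a list"
  assume len: "\<forall>i. length (r i) = p \<and> length (s i) = fst f \<and> length (t i) = q"
    and "matrix_of m' (p + (fst f + q)) (\<lambda>i. r i @ s i @ t i) \<in> block_images F m n x"
  then obtain gs where gs: "set gs \<subseteq> F" "sum_list (map fst gs) = n"
    and eq: "matrix_of m' (p + (fst f + q)) (\<lambda>i. r i @ s i @ t i) =
      matrix_of m (length gs) (\<lambda>i. apply_blocks gs (x i))"
    by (auto simp: block_images_def)
  have m: "m' = m" using eq by (metis matrix_of_carrier carrier_matD(1))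
  have lgs: "length gs = p + (fst f + q)"
    and rows: "\<And>i. i < m \<Longrightarrow> apply_blocks gs (x i) = r i @ s i @ t i"
    using eq len unfolding m by (subst (asm) matrix_of_eq_iff; simp)+
  obtain g1 g2 g3 where g: "gs = g1 @ g2 @ g3"
    and lg: "length g1 = p" "length g2 = fst f" "length g3 = q"
  proof
    show "gs = take p gs @ take (fst f) (drop p gs) @ drop (fst f) (drop p gs)"
      by (simp only: append_take_drop_id)
  qed (use lgs in auto)
  let ?h = "superposition A f g2"
  have "r i @ [snd f (s i)] @ t i = apply_blocks (g1 @ [?h] @ g3) (x i)" if "i < m" for i
  proof -
    \<comment> \<open>\<open>?y\<close> is what remains of the row after the blocks of
      \<open>g1\<close>; its first \<open>?k\<close> entries are the input of \<open>g2\<close>, the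
      rest that of \<open>g3\<close>.\<close>
    let ?y = "drop (sum_list (map fst g1)) (x i)" and ?k = "sum_list (map fst g2)"
    have "r i = apply_blocks g1 (x i)" "s i = apply_blocks g2 ?y"
      "t i = apply_blocks g3 (drop ?k ?y)"
      using rows[OF that] len lg by (simp_all add: g apply_blocks_append)
    moreover have "take ?k ?y \<in> nlists ?k A"
      using x[OF that] gs(2) by (auto simp: g in_nlists_iff dest!: in_set_takeD in_set_dropD)
    then have "snd ?h (take ?k ?y) = snd f (apply_blocks g2 ?y)"
      by (simp add: superposition_apply apply_blocks_take)
    ultimately show ?thesis
      \<comment> \<open>\<open>apply_blocks\<close> unfolds only on explicit pairs, hence the split
        of \<open>?h\<close>. The flipped equation turns \<open>?k\<close> into the arity of
        \<open>?h\<close>, so both sides cut the row at the same place.\<close>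
      by (cases ?h) (simp add: apply_blocks_append flip: fst_superposition[of A f g2])
  qed
  then have "matrix_of m' (p + (1 + q)) (\<lambda>i. r i @ [snd f (s i)] @ t i) =
      matrix_of m (length (g1 @ [?h] @ g3)) (\<lambda>i. apply_blocks (g1 @ [?h] @ g3) (x i))"
    unfolding m using lg by (intro matrix_of_cong) auto
  moreover have "?h \<in> F" using F f gs(1) lg(2) by (auto simp: preclone_def g)
  then have "set (g1 @ [?h] @ g3) \<subseteq> F" "sum_list (map fst (g1 @ [?h] @ g3)) = n"
    using gs by (auto simp: g)
  ultimately show
    "matrix_of m' (p + (1 + q)) (\<lambda>i. r i @ [snd f (s i)] @ t i) \<in> block_images F m n x"
    unfolding block_images_def by blast
qed

lemma apply_blocks_identity_operation:
  assumes "set xs \<subseteq> A"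
  shows "apply_blocks (replicate (length xs) (identity_operation A)) xs = xs"
  using assms by (induction xs) (simp_all add: identity_operation_def in_nlists_iff)

text \<open>Cut every row into blocks of length 1 and apply the identity to each.\<close>

lemma matrix_of_in_block_images:
  assumes "identity_operation A \<in> F" "\<And>i. i < m \<Longrightarrow> x i \<in> nlists n A"
  shows "matrix_of m n x \<in> block_images F m n x"
proof -
  let ?gs = "replicate n (identity_operation A)"
  have "apply_blocks ?gs (x i) = x i" if "i < m" for i
    using assms(2)[OF that] apply_blocks_identity_operation[of "x i" A] by (auto simp: in_nlists_iff)
  then have "matrix_of m n x = matrix_of m (length ?gs) (\<lambda>i. apply_blocks ?gs (x i))"
    by (intro matrix_of_cong) auto
  moreover have "set ?gs \<subseteq> F" "sum_list (map fst ?gs) = n"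
    using assms(1) by (auto simp: identity_operation_def sum_list_replicate)
  ultimately show ?thesis unfolding block_images_def by blast
qed

text \<open>The only collection tested is the one generated by the matrix whose rows enumerate
  \<open>S\<close>.\<close>

lemma interpolation_if_preserves:
  assumes F: "preclone A F"
    and f: "\<And>\<Gamma>. \<Gamma> \<in> matrix_collections A \<Longrightarrow> \<forall>g\<in>F. preserves g \<Gamma> \<Longrightarrow> preserves (n, f) \<Gamma>"
    and S: "finite S" "S \<subseteq> nlists n A" "S \<noteq> {}"
  shows "\<exists>g. (n, g) \<in> F \<and> (\<forall>xs\<in>S. f xs = g xs)"
proof -
  obtain ys where ys: "set ys = S" using S(1) finite_list by blast
  define m where "m = length ys"
  \<comment> \<open>The junk row beyond \<open>m\<close> only has to have the right length.\<close>
  define x where "x = (\<lambda>i. if i < m then ys ! i else replicate n undefined)"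
  have x: "x i \<in> nlists n A" if "i < m" for i
    using that S(2) ys by (auto simp: x_def m_def)
  then have len: "length (x i) = n" for i
    by (cases "i < m") (auto simp: x_def in_nlists_iff)
  \<comment> \<open>A matrix collection has positive arity; this is where \<open>S\<close> must be
    nonempty.\<close>
  have "m \<ge> 1" using ys S(3) by (cases ys) (auto simp: m_def)
  have "block_images F m n x \<in> matrix_collections A"
    using F x \<open>m \<ge> 1\<close> by (intro block_images_in_matrix_collections) (auto simp: preclone_def)
  then have "preserves (n, f) (block_images F m n x)"
    using preserves_block_images[OF F _ x] by (intro f) auto
  moreover have "matrix_of m n x \<in> block_images F m n x"
    using F x by (intro matrix_of_in_block_images) (auto simp: preclone_def)
  \<comment> \<open>With empty left and right parts, \<open>f\<close> is applied to the whole matrix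
    at once.\<close>
  ultimately have "matrix_of m 1 (\<lambda>i. [f (x i)]) \<in> block_images F m n x"
    using preservesD[of "(n, f)" _ "\<lambda>_. []" 0 x "\<lambda>_. []" 0 m] len by simp
  then obtain gs where gs: "set gs \<subseteq> F" "sum_list (map fst gs) = n"
    and eq: "matrix_of m 1 (\<lambda>i. [f (x i)]) = matrix_of m (length gs) (\<lambda>i. apply_blocks gs (x i))"
    by (auto simp: block_images_def)
  \<comment> \<open>A single output column forces \<open>gs\<close> to have one member, whose arity
    is then the total arity \<open>n\<close>.\<close>
  have "length gs = 1" and rows: "\<forall>i<m. apply_blocks gs (x i) = [f (x i)]"
    using eq by (subst (asm) matrix_of_eq_iff; simp)+
  then obtain g where g: "gs = [(n, g)]"
    using gs(2) by (auto simp: length_Suc_conv)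
  have "f y = g y" if "y \<in> S" for y
  proof -
    obtain i where "i < m" "ys ! i = y"
      using \<open>y \<in> S\<close> ys by (metis in_set_conv_nth m_def)
    then have "y = x i" by (simp add: x_def)
    then show ?thesis using rows len[of i] \<open>i < m\<close> by (auto simp: g)
  qed
  then show ?thesis using gs(1) g by auto
qed

section \<open>Both implications of the characterization\<close>

theorem theorem2:
  fixes A :: "'a set" and F :: "'a operation set"
  assumes "A \<noteq> {}" and "F \<subseteq> operations A"
  shows "preclone A F \<and> locally_closed A F \<longleftrightarrow>
    (\<exists>\<M>. \<M> \<subseteq> matrix_collections A \<and> F = {f \<in> operations A. \<forall>\<Gamma>\<in>\<M>. preserves f \<Gamma>})"
proof
  assume "preclone A F \<and> locally_closed A F"
  then have F: "preclone A F" and closed: "locally_closed A F" by auto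
  \<comment> \<open>The largest candidate: all collections preserved by the whole of
    \<open>F\<close>. Then \<open>F\<close> is contained in the characterized set at once, and only
    the reverse inclusion needs local closure.\<close>
  define \<M> where "\<M> = {\<Gamma> \<in> matrix_collections A. \<forall>f\<in>F. preserves f \<Gamma>}"
  have "(n, f) \<in> F" if nf: "(n, f) \<in> operations A" and pres: "\<forall>\<Gamma>\<in>\<M>. preserves (n, f) \<Gamma>" for n f
  proof -
    have "n \<ge> 1" "f \<in> nlists n A \<rightarrow>\<^sub>E A"
      using nf by (auto simp: operations_def operations_of_arity_def)
    moreover have "\<exists>g. (n, g) \<in> F \<and> (\<forall>xs\<in>S. f xs = g xs)"
      if S: "finite S" "S \<subseteq> nlists n A" for S
    proof -
      obtain a where "a \<in> A" using assms(1) by blast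
      \<comment> \<open>For empty \<open>S\<close> one still needs some \<open>n\<close>-ary member of \<open>F\<close>, so \<open>S\<close> is enlarged.\<close>
      then have "insert (replicate n a) S \<subseteq> nlists n A"
        using S(2) by (auto simp: in_nlists_iff)
      then have "\<exists>g. (n, g) \<in> F \<and> (\<forall>xs\<in>insert (replicate n a) S. f xs = g xs)"
        using S(1) pres by (intro interpolation_if_preserves[OF F]) (auto simp: \<M>_def)
      then show ?thesis by blast
    qed
    ultimately show ?thesis
      by (intro closed[unfolded locally_closed_def, rule_format]) simp_all
  qed
  then have "F = {f \<in> operations A. \<forall>\<Gamma>\<in>\<M>. preserves f \<Gamma>}"
    using assms(2) by (auto simp: \<M>_def)
  then show "\<exists>\<M>. \<M> \<subseteq> matrix_collections A \<and> F = {f \<in> operations A. \<forall>\<Gamma>\<in>\<M>. preserves f \<Gamma>}"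
    by (intro exI[of _ \<M>]) (auto simp: \<M>_def)
next
  assume "\<exists>\<M>. \<M> \<subseteq> matrix_collections A \<and> F = {f \<in> operations A. \<forall>\<Gamma>\<in>\<M>. preserves f \<Gamma>}"
  then obtain \<M> where \<M>: "\<M> \<subseteq> matrix_collections A"
    and F: "F = {f \<in> operations A. \<forall>\<Gamma>\<in>\<M>. preserves f \<Gamma>}" by blast
  have "superposition A f gs \<in> F" if "f \<in> F" "set gs \<subseteq> F" "length gs = fst f" for f gs
  proof -
    have "superposition A f gs \<in> operations A"
      using that assms(2) by (intro superposition_in_operations) auto
    moreover have "preserves (superposition A f gs) \<Gamma>" if "\<Gamma> \<in> \<M>" for \<Gamma>
      using that \<open>f \<in> F\<close> \<open>set gs \<subseteq> F\<close> \<open>length gs = fst f\<close> \<M> F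
      by (intro preserves_superposition) auto
    ultimately show ?thesis by (simp add: F)
  qed
  moreover have "identity_operation A \<in> F"
    using \<M> by (auto simp: F identity_operation_in_operations preserves_identity_operation)
  moreover have "locally_closed A F"
    unfolding locally_closed_def
  proof (intro allI impI ballI)
    fix n f
    assume "1 \<le> n" "f \<in> nlists n A \<rightarrow>\<^sub>E A"
      and loc: "\<forall>S. finite S \<and> S \<subseteq> nlists n A \<longrightarrow> (\<exists>g. (n, g) \<in> F \<and> (\<forall>xs\<in>S. f xs = g xs))"
    then have "(n, f) \<in> operations A"
      by (auto simp: operations_def operations_of_arity_def)
    moreover have "preserves (n, f) \<Gamma>" if "\<Gamma> \<in> \<M>" for \<Gamma>
    proof (rule preserves_local)
      show "\<Gamma> \<in> matrix_collections A" using that \<M> by blast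
    next
      fix S assume "finite S" "S \<subseteq> nlists n A"
      then obtain g where "(n, g) \<in> F" "\<forall>xs\<in>S. f xs = g xs" using loc by blast
      then show "\<exists>g. preserves (n, g) \<Gamma> \<and> (\<forall>xs\<in>S. f xs = g xs)" using F that by blast
    qed
    ultimately show "(n, f) \<in> F" by (simp add: F)
  qed
  ultimately show "preclone A F \<and> locally_closed A F"
    using assms(2) by (simp add: preclone_def)
qed

end
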